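(* Let $k\ge 1$ be an integer, let $\alpha=[1;k,1,k,1,k,\ldots]$ and $\beta=[k+1;1,k,1,k,1,\ldots]$ (continued fractions), and let $S_k=\{(\lfloor n\alpha\rfloor,\lfloor n\beta\rfloor)\mid n\in\mathbb{N}\}$, where $\mathbb{N}=\{0,1,2,\ldots\}$. Consider the impartial two-heap game $\Gamma_k$ whose permitted moves are exactly the following (here $n,s,t$ denote positive integers): Type I (Nim moves): $(x,y)\to(x-n,y)$ or $(x,y)\to(x,y-n)$. Type II (extended diagonal moves): $(x,y)\to(x-s,y-t)$ provided that $|s-t|<k$. Type III (extra moves): for each $i\in\{1,\ldots,k-1\}$ put $(f^i_0,g^i_0)=(0,i+1)$ and, for $n>0$, $$(f^i_n,g^i_n)=(f^i_{n-1}+g^i_{n-1},\ kf^i_{n-1}+(k+1)g^i_{n-1}+i);$$ the extra moves for $i$ are the moves $(f^i_n,g^i_n-1)$ for $n>0$. Then the set of P-positions of $\Gamma_k$ is identical to $S_k$.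
   Context: Closed forms: $\alpha=\frac{1+\sqrt{1+4/k}}{2}$ and $\beta=\frac{k+2+k\sqrt{1+4/k}}{2}=k\alpha+1$, so that $\alpha^{-1}+\beta^{-1}=1$. A position is a pair of heaps with $x\ge 0$ and $y\ge 0$ tokens, written $(x,y)$ and regarded as an unordered multiset, so $(x,y)$ and $(y,x)$ are identified (in particular, the elements of $S_k$ are read as unordered pairs). A move $(u,v)$ denotes removing $u$ tokens from one of the heaps and $v$ from the other; from $(x,y)$ it permits $(x,y)\to(x-u,y-v)$ if both coordinates of the result are nonnegative, and also $(x,y)\to(x-v,y-u)$ if both coordinates of the result are nonnegative. The ruleset is invariant: the available moves do not depend on the position, apart from the requirement that the resulting heap sizes be nonnegative. Two players alternate moves and a player unable to move loses (normal play). A position is a P-position if the player who is not about to move (the second player) has a winning strategy; equivalently, a position is a P-position if and only if no move from it leads to a P-position. For $k=1$ there are no Type III moves. *)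

theory Defs
  imports Complex_Main "HOL-Library.Uprod"
begin

text \<open>The simple continued fraction $[a_0; a_1, a_2, \ldots]$: \<open>cf_convergent a n\<close> is the finite
  continued fraction $[a_0; a_1, \ldots, a_n]$.\<close>

primrec cf_convergent :: "(nat \<Rightarrow> nat) \<Rightarrow> nat \<Rightarrow> real" where
  "cf_convergent a 0 = real (a 0)"
| "cf_convergent a (Suc n) = real (a 0) + 1 / cf_convergent (\<lambda>j. a (Suc j)) n"

definition cf_value :: "(nat \<Rightarrow> nat) \<Rightarrow> real" where
  "cf_value a = lim (cf_convergent a)"

definition alpha :: "nat \<Rightarrow> real" where
  "alpha k = cf_value (\<lambda>j. if even j then 1 else k)"

definition beta :: "nat \<Rightarrow> real" where
  "beta k = cf_value (\<lambda>j. if j = 0 then k + 1 else if odd j then 1 else k)"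

text \<open>A position is an unordered pair of heap sizes.\<close>

definition S :: "nat \<Rightarrow> nat uprod set" where
  "S k = {Upair (nat \<lfloor>real n * alpha k\<rfloor>) (nat \<lfloor>real n * beta k\<rfloor>) | n. True}"

text \<open>The positions from which the second player has a winning strategy in the normal-play game
  whose options are given by \<open>R\<close>: every move of the first player can be answered by a move to
  a position of the same kind.  Being a least fixed point, this demands that the play
  eventually ends.\<close>

inductive P_position :: "('p \<Rightarrow> 'p \<Rightarrow> bool) \<Rightarrow> 'p \<Rightarrow> bool" for R :: "'p \<Rightarrow> 'p \<Rightarrow> bool" where
  "(\<And>q. R p q \<Longrightarrow> \<exists>r. R q r \<and> P_position R r) \<Longrightarrow> P_position R p"

text \<open>The game with the set \<open>M\<close> of permitted moves.  As \<open>Upair x y = Upair y x\<close>, a move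
  \<open>(u, v)\<close> may remove \<open>u\<close> tokens from either of the heaps and \<open>v\<close> from the other one.\<close>

inductive two_heap_move :: "(nat \<times> nat) set \<Rightarrow> nat uprod \<Rightarrow> nat uprod \<Rightarrow> bool"
  for M :: "(nat \<times> nat) set" where
  "(u, v) \<in> M \<Longrightarrow> u \<le> x \<Longrightarrow> v \<le> y \<Longrightarrow> two_heap_move M (Upair x y) (Upair (x - u) (y - v))"

primrec extra_seq :: "nat \<Rightarrow> nat \<Rightarrow> nat \<Rightarrow> nat \<times> nat" where
  "extra_seq k i 0 = (0, i + 1)"
| "extra_seq k i (Suc n) =
     (let (f, g) = extra_seq k i n in (f + g, k * f + (k + 1) * g + i))"

definition nim_moves :: "(nat \<times> nat) set" where
  "nim_moves = {(n, 0) | n. n > 0}"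

definition diagonal_moves :: "nat \<Rightarrow> (nat \<times> nat) set" where
  "diagonal_moves k = {(s, t). s > 0 \<and> t > 0 \<and> \<bar>int s - int t\<bar> < int k}"

text \<open>The second components of \<open>extra_seq\<close> are positive, so the subtraction does not truncate.\<close>

definition extra_moves :: "nat \<Rightarrow> (nat \<times> nat) set" where
  "extra_moves k =
     {(fst (extra_seq k i n), snd (extra_seq k i n) - 1) | i n. 1 \<le> i \<and> i \<le> k - 1 \<and> n > 0}"

definition Gamma_move :: "nat \<Rightarrow> nat uprod \<Rightarrow> nat uprod \<Rightarrow> bool" where
  "Gamma_move k = two_heap_move (nim_moves \<union> diagonal_moves k \<union> extra_moves k)"

text \<open>In a game without infinite plays, a position is a P-position if and only if no move from
  it leads to a P-position; the games considered here have no infinite plays.\<close>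

lemma P_position_iff:
  assumes "wfP (\<lambda>q p. R p q)"
  shows "P_position R p \<longleftrightarrow> (\<forall>q. R p q \<longrightarrow> \<not> P_position R q)"
  using assms
proof (induction p rule: wfp_induct_rule)
  case (less p)
  show ?case
  proof
    assume "P_position R p"
    then show "\<forall>q. R p q \<longrightarrow> \<not> P_position R q"
      using less.IH by (metis P_position.cases)
  next
    assume "\<forall>q. R p q \<longrightarrow> \<not> P_position R q"
    then show "P_position R p"
      using less.IH by (metis P_position.intros)
  qed
qed

lemma extra_seq_pos: "snd (extra_seq k i n) > 0" "n > 0 \<Longrightarrow> fst (extra_seq k i n) > 0"
proof -
  show pos: "snd (extra_seq k i n) > 0" for n
    by (induction n) (auto simp: Let_def split: prod.splits)
  show "n > 0 \<Longrightarrow> fst (extra_seq k i n) > 0"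
    using pos[of "n - 1"] by (cases n) (auto simp: Let_def split: prod.splits)
qed

lift_definition tokens :: "nat uprod \<Rightarrow> nat" is "\<lambda>(x, y). x + y"
  by (auto simp: eq_upair_def)

lemma Gamma_move_tokens:
  assumes "Gamma_move k p q"
  shows "tokens q < tokens p"
  using assms unfolding Gamma_move_def
proof cases
  case (1 u v x y)
  then have "u > 0"
    using extra_seq_pos(2)
    by (auto simp: nim_moves_def diagonal_moves_def extra_moves_def)
  moreover have "tokens (Upair a b) = a + b" for a b
    by transfer simp
  ultimately show ?thesis
    using 1 by simp
qed

lemma Gamma_P_position_iff:
  "P_position (Gamma_move k) p \<longleftrightarrow> (\<forall>q. Gamma_move k p q \<longrightarrow> \<not> P_position (Gamma_move k) q)"
  by (intro P_position_iff wfp_if_convertible_to_nat[of _ tokens] Gamma_move_tokens)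

end

theory Submission
  imports Defs
begin

text \<open>Write \<open>(A n, B n)\<close> for the elements of \<open>S k\<close> and \<open>t = alpha k - 1\<close>, so that \<open>k t (1 + t) = 1\<close>.
  The recursion matrix of the extra moves contracts the linear form \<open>phi x y = y - k (1 + t) x\<close> by
  the factor \<open>1 / beta k\<close>.  On \<open>S k\<close> the values of \<open>phi\<close> lie in the intervals
  \<open>[j (1 + t), j (1 + t) + t)\<close> for \<open>0 \<le> j < k\<close>, and \<open>phi\<close> sends the pair \<open>(f, g)\<close> with indices \<open>i\<close>
  and \<open>n\<close> to a number slightly above \<open>i (1 + t)\<close>; hence an extra move changes \<open>phi\<close> by an amount that
  is not a difference of two such values.  Conversely, \<open>A\<close> and \<open>B\<close> cover the natural numbers
  (Beatty), and \<open>B n - A n\<close> grows by \<open>k\<close> or \<open>k + 1\<close>.  The Nim and diagonal moves lead into \<open>S k\<close> from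
  everywhere outside except from \<open>(A n, B n - 1)\<close> after a step \<open>k + 1\<close>.  In that case
  \<open>phi (A n) (B n)\<close> lies slightly above some \<open>i (1 + t)\<close> with \<open>i \<ge> 1\<close>, and subtracting a suitable
  pair \<open>(f, g)\<close> for this \<open>i\<close> leaves \<open>phi\<close> in \<open>[0, t)\<close>, that is, a point of \<open>S k\<close>.\<close>

lemma Upair_commute: "Upair x y = Upair y x"
  by simp

section \<open>Continued fractions: convergence and the quadratic equation\<close>

lemma cf_convergent_ge:
  assumes "\<And>j. a j \<ge> 1"
  shows "cf_convergent a n \<ge> real (a 0)"
  using assms
proof (induction n arbitrary: a)
  case (Suc n)
  have "cf_convergent (\<lambda>j. a (Suc j)) n \<ge> real (a (Suc 0))"
    by (rule Suc.IH) (rule Suc.prems)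
  moreover have "real (a (Suc 0)) \<ge> 1"
    using Suc.prems[of "Suc 0"] by simp
  ultimately show ?case by simp
qed simp

text \<open>Error estimate for one step \<open>z \<mapsto> c + 1 / z\<close> of a continued
  fraction: as \<open>x\<close> is at least 1, dividing by it cannot enlarge the error, and the
  limit \<open>y\<close> supplies the factor \<open>1 / y\<close>.\<close>

lemma inverse_dist_le:
  fixes x y :: real
  assumes "x \<ge> 1" "y > 0"
  shows "\<bar>1 / x - 1 / y\<bar> \<le> \<bar>x - y\<bar> / y"
proof -
  have "\<bar>1 / x - 1 / y\<bar> = \<bar>x - y\<bar> / y / x"
    using assms by (simp add: divide_simps abs_mult abs_minus_commute)
  also have "\<dots> \<le> \<bar>x - y\<bar> / y"
    using assms by (simp add: divide_le_eq mult_le_cancel_left1)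
  finally show ?thesis .
qed

locale wythoff_game =
  fixes k :: nat
  assumes k_pos: "k \<ge> 1"
begin

lemma ex_alpha: "\<exists>a::real. a > 1 \<and> k * a * a = k * a + 1"
proof -
  define a :: real where "a = (1 + sqrt (1 + 4 / k)) / 2"
  have s: "sqrt (1 + 4 / k) * sqrt (1 + 4 / k) = 1 + 4 / k" by simp
  have "a * a = a + 1 / k"
    using s by (simp add: a_def field_simps)
  then have "k * (a * a) = k * (a + 1 / k)" by simp
  then have "k * a * a = k * a + 1"
    using k_pos by (simp add: algebra_simps)
  moreover have "sqrt (1 + 4 / k) > 1"
    using k_pos by simp
  then have "a > 1" by (simp add: a_def)
  ultimately show ?thesis by blast
qed

text \<open>Each of the two periodic fractions is the tail of the other, and
  \<open>a = 1 + 1 / (k * a)\<close>, \<open>k * a = k + 1 / a\<close>; hence the joint induction.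
  Since \<open>k * a \<ge> a\<close>, every step shrinks the error at least by the factor
  \<open>1 / a\<close>.\<close>

lemma cf_convergent_dist:
  fixes a :: real
  assumes "a > 1" "k * a * a = k * a + 1"
  shows "\<bar>cf_convergent (\<lambda>j. if even j then 1 else k) n - a\<bar> \<le> (1 / a) ^ n"
    and "\<bar>cf_convergent (\<lambda>j. if even j then k else 1) n - k * a\<bar> \<le> (1 / a) ^ n"
proof (induction n)
  case 0
  have k: "real k \<ge> 1" using k_pos by simp
  have ka: "k * a * (a - 1) = 1" using assms by (simp add: algebra_simps)
  have "k * a \<ge> 1" using k assms(1) by (smt (verit) mult_le_cancel_left1)
  then have "a - 1 \<le> k * a * (a - 1)" using assms(1) by simp
  then have "a \<le> 2" using ka by linarith
  then show "\<bar>cf_convergent (\<lambda>j. if even j then 1 else k) 0 - a\<bar> \<le> (1 / a) ^ 0"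
    using assms(1) by simp
  have "k * (a - 1) \<ge> 0" "k * (a - 1) \<le> k * (a - 1) * a"
    using k assms(1) by simp_all
  then show "\<bar>cf_convergent (\<lambda>j. if even j then k else 1) 0 - k * a\<bar> \<le> (1 / a) ^ 0"
    using ka by (simp add: algebra_simps)
next
  case (Suc n)
  let ?A = "cf_convergent (\<lambda>j. if even j then 1 else k) n"
  let ?B = "cf_convergent (\<lambda>j. if even j then k else 1) n"
  have A: "?A \<ge> 1" using cf_convergent_ge[of "\<lambda>j. if even j then 1 else k" n] k_pos by simp
  have k: "real k \<ge> 1" using k_pos by simp
  have "?B \<ge> k" using cf_convergent_ge[of "\<lambda>j. if even j then k else 1" n] k_pos by simp
  then have B: "?B \<ge> 1" using k by linarith
  have ka: "k * a \<ge> a" using k assms(1) by simp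
  have ka0: "k * a > 0" using ka assms(1) by linarith
  have if_not: "(if \<not> b then x else y) = (if b then y else x)" for b and x y :: nat by simp
  have convs: "cf_convergent (\<lambda>j. if even j then 1 else k) (Suc n) = 1 + 1 / ?B"
    "cf_convergent (\<lambda>j. if even j then k else 1) (Suc n) = k + 1 / ?A"
    by (simp_all add: if_not)
  have "(a - 1) * (k * a) = 1" "(k * a - k) * a = 1"
    using assms(2) by (simp_all add: algebra_simps)
  then have "1 / (k * a) = a - 1" "1 / a = k * a - k"
    using assms(1) ka0 by (metis less_numeral_extra(3) nonzero_eq_divide_eq,
      metis not_one_less_zero nonzero_eq_divide_eq)
  then have eqs: "a = 1 + 1 / (k * a)" "k * a = k + 1 / a" by simp_all
  have "\<bar>1 / ?B - 1 / (k * a)\<bar> \<le> \<bar>?B - k * a\<bar> / (k * a)"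
    using B ka0 by (rule inverse_dist_le)
  also have "\<dots> \<le> \<bar>?B - k * a\<bar> / a"
    using ka assms(1) ka0 by (intro divide_left_mono) auto
  also have "\<dots> \<le> (1 / a) ^ n / a"
    using Suc assms(1) by (intro divide_right_mono) auto
  finally have "\<bar>1 + 1 / ?B - (1 + 1 / (k * a))\<bar> \<le> (1 / a) ^ Suc n" by simp
  then show "\<bar>cf_convergent (\<lambda>j. if even j then 1 else k) (Suc n) - a\<bar> \<le> (1 / a) ^ Suc n"
    unfolding convs using eqs(1) by argo
  have "\<bar>1 / ?A - 1 / a\<bar> \<le> \<bar>?A - a\<bar> / a"
    using A assms(1) by (intro inverse_dist_le) auto
  also have "\<dots> \<le> (1 / a) ^ n / a"
    using Suc assms(1) by (intro divide_right_mono) auto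
  finally show "\<bar>cf_convergent (\<lambda>j. if even j then k else 1) (Suc n) - k * a\<bar> \<le> (1 / a) ^ Suc n"
    unfolding convs by (subst eqs(2)) simp
qed

lemma cf_convergent_tendsto:
  fixes a :: real
  assumes "a > 1" "k * a * a = k * a + 1"
  shows "cf_convergent (\<lambda>j. if even j then 1 else k) \<longlonglongrightarrow> a"
proof -
  have "(\<lambda>n. (1 / a) ^ n) \<longlonglongrightarrow> 0"
    using assms(1) by (intro LIMSEQ_realpow_zero) auto
  then have "(\<lambda>n. cf_convergent (\<lambda>j. if even j then 1 else k) n - a) \<longlonglongrightarrow> 0"
    
    by (rule tendsto_0_le[where K = 1])
       (use cf_convergent_dist(1)[OF assms] assms(1) in \<open>simp del: cf_convergent.simps\<close>)
  then show ?thesis by (rule LIM_zero_cancel)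
qed

text \<open>After its first entry the fraction of \<open>beta k\<close> repeats that of
  \<open>alpha k\<close>, so its value is \<open>k + 1 + 1 / alpha k\<close>; the quadratic equation
  turns this into \<open>k * alpha k + 1\<close>.\<close>

lemma alpha_eq: "alpha k > 1" "k * alpha k * alpha k = k * alpha k + 1"
  and beta_eq: "beta k = k * alpha k + 1"
proof -
  obtain a :: real where a: "a > 1" "k * a * a = k * a + 1"
    using ex_alpha by blast
  note lim = cf_convergent_tendsto[OF a]
  then have al: "alpha k = a"
    by (simp add: alpha_def cf_value_def limI)
  show "alpha k > 1" "k * alpha k * alpha k = k * alpha k + 1"
    using a al by simp_all
  let ?b = "\<lambda>j. if j = 0 then k + 1 else if odd j then 1 else k"
  have "(\<lambda>n. (k + 1) + 1 / cf_convergent (\<lambda>j. if even j then 1 else k) n) \<longlonglongrightarrow> (k + 1) + 1 / a"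
    using lim a(1) by (intro tendsto_intros) auto
  then have "(\<lambda>n. cf_convergent ?b (Suc n)) \<longlonglongrightarrow> (k + 1) + 1 / a"
    by (simp cong: if_cong)
  then have "cf_convergent ?b \<longlonglongrightarrow> (k + 1) + 1 / a"
    using LIMSEQ_imp_Suc by blast
  moreover have "(k * a - k) * a = 1"
    using a(2) by (simp add: algebra_simps)
  then have "1 / a = k * a - k"
    using a(1) by (metis not_one_less_zero nonzero_eq_divide_eq)
  ultimately have "cf_convergent ?b \<longlonglongrightarrow> k * a + 1" by (simp add: add.commute)
  then show "beta k = k * alpha k + 1"
    unfolding al beta_def cf_value_def by (rule limI)
qed

section \<open>The number \<open>t\<close> and its irrationality\<close>

definition t :: real where "t = alpha k - 1"

lemma alpha_t: "alpha k = 1 + t" by (simp add: t_def)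

lemma t_pos: "t > 0" using alpha_eq(1) by (simp add: t_def)

lemma t_eq: "k * t * t = 1 - k * t"
  using alpha_eq(2) by (simp add: t_def algebra_simps)

lemma kt_pos: "k * t > 0" using k_pos t_pos by simp

lemma kt_less_1: "k * t < 1"
  using t_eq mult_pos_pos[OF kt_pos t_pos] by linarith

lemma t_less_1: "t < 1"
proof -
  have "t \<le> k * t" using k_pos t_pos by simp
  then show ?thesis using kt_less_1 by linarith
qed

lemma beta_t: "beta k = k + 1 + k * t"
  using beta_eq by (simp add: alpha_t algebra_simps)

text \<open>Infinite descent along \<open>n \<mapsto> n / beta k\<close>, which preserves the property that \<open>n\<close> and
  \<open>n * alpha k\<close> are integers.\<close>

lemma t_irrational:
  assumes "n > 0"
  shows "real n * t \<noteq> of_int p"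
  using assms
proof (induction n arbitrary: p rule: less_induct)
  case (less n)
  show ?case
  proof
    assume p: "real n * t = of_int p"
    define m where "m = int n - int k * p"
    have m: "of_int m = real n * (1 - k * t)"
      using p by (simp add: m_def algebra_simps)
    have "real n * (1 - k * t) > 0" "real n * (1 - k * t) < real n"
      using less.prems kt_less_1 kt_pos by simp_all
    then have "m > 0" "m < int n"
      using m by linarith+
    then have n: "nat m < n" "nat m > 0" "real (nat m) = of_int m" by simp_all
    have "k * t * (t * n) = (1 - k * t) * n"
      using t_eq by (metis mult.assoc)
    then have "real (nat m) * t = of_int (p - m)"
      unfolding n(3) of_int_diff p[symmetric] m
      using \<open>k * t * (t * n) = (1 - k * t) * n\<close> by (simp add: algebra_simps)

    then show False using less.IH n by blast
  qed
qed

section \<open>The sequences \<open>A\<close> and \<open>B\<close> and Beatty's theorem\<close>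

definition A :: "nat \<Rightarrow> nat" where "A n = nat \<lfloor>real n * alpha k\<rfloor>"
definition B :: "nat \<Rightarrow> nat" where "B n = nat \<lfloor>real n * beta k\<rfloor>"

lemma A_eq: "int (A n) = int n + \<lfloor>n * t\<rfloor>"
proof -
  have "real n * alpha k = n * t + of_int (int n)" by (simp add: alpha_t algebra_simps)
  then have "\<lfloor>real n * alpha k\<rfloor> = \<lfloor>n * t\<rfloor> + int n"
    by (metis floor_add_int)
  then show ?thesis using t_pos by (simp add: A_def)
qed

lemma B_eq: "int (B n) = int n * (k + 1) + \<lfloor>k * (n * t)\<rfloor>"
proof -
  have "real n * beta k = k * (n * t) + of_int (int n * (k + 1))"
    by (simp add: beta_t algebra_simps)
  then have "\<lfloor>real n * beta k\<rfloor> = \<lfloor>k * (n * t)\<rfloor> + int n * (k + 1)"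
    by (metis floor_add_int)
  then show ?thesis using t_pos by (simp add: B_def)
qed

lemma A_0 [simp]: "A 0 = 0" and B_0 [simp]: "B 0 = 0"
  by (simp_all add: A_def B_def)

text \<open>Thus \<open>k * t\<close> is the reciprocal of \<open>alpha k\<close>, and by the next
  lemma \<open>1 - k * t\<close> is that of \<open>beta k\<close>. That these reciprocals add up to
  1 is Beatty's condition.\<close>

lemma kt_alpha: "k * t * (1 + t) = 1"
  using t_eq by (simp add: algebra_simps)

lemma kt_beta: "(1 - k * t) * (k + 1 + k * t) = 1"
proof -
  have "(1 - k * t) * (k + 1 + k * t) = 1 + k * (1 - k * t * (1 + t))"
    by (simp add: algebra_simps)
  then show ?thesis using kt_alpha by simp
qed

lemma A_bounds: "real (A n) \<le> n * (1 + t)" "n * (1 + t) < real (A n) + 1"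
proof -
  have "real (A n) = of_int \<lfloor>n * (1 + t)\<rfloor>"
    using t_pos by (simp add: A_def alpha_t)
  then show "real (A n) \<le> n * (1 + t)" "n * (1 + t) < real (A n) + 1" by linarith+
qed

lemma B_bounds: "real (B n) \<le> n * (k + 1 + k * t)" "n * (k + 1 + k * t) < real (B n) + 1"
proof -
  have "real (B n) = of_int \<lfloor>n * (k + 1 + k * t)\<rfloor>"
    using t_pos by (simp add: B_def beta_t)
  then show "real (B n) \<le> n * (k + 1 + k * t)" "n * (k + 1 + k * t) < real (B n) + 1" by linarith+
qed

lemma A_eqI:
  assumes "real x \<le> n * (1 + t)" "n * (1 + t) < real x + 1"
  shows "A n = x"
  using assms A_bounds[of n] by linarith

lemma B_eqI:
  assumes "real x \<le> n * (k + 1 + k * t)" "n * (k + 1 + k * t) < real x + 1"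
  shows "B n = x"
  using assms B_bounds[of n] by linarith

text \<open>If the first multiple of \<open>alpha k\<close> above \<open>x\<close> is below
  \<open>x + 1\<close>, then \<open>x\<close> is a value of \<open>A\<close>. Otherwise
  \<open>n \<le> x / alpha k\<close> and \<open>(x + 1) / alpha k \<le> n + 1\<close>; taking
  complements to \<open>x\<close> and \<open>x + 1\<close> puts \<open>x - n\<close> between
  \<open>x / beta k\<close> and \<open>(x + 1) / beta k\<close>, with irrationality excluding the
  upper end.\<close>

lemma A_or_B: "\<exists>n. x = A n \<or> x = B n"
proof -
  define n where "n = nat \<lfloor>x / (1 + t)\<rfloor>"
  have "real n \<le> x / (1 + t)" "x / (1 + t) < real n + 1"
    unfolding n_def using t_pos by simp_all
  then have n: "n * (1 + t) \<le> x" "x < (real n + 1) * (1 + t)"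
    using t_pos by (simp_all add: field_simps)
  show ?thesis
  proof (cases "(real n + 1) * (1 + t) < x + 1")
    case True
    then have "A (Suc n) = x"
      using n(2) by (intro A_eqI) (simp_all add: add.commute)
    then show ?thesis by blast
  next
    case False
    have scale: "z * (1 + t) * (k * t) = z" for z :: real
      using kt_alpha by (metis mult.assoc mult.commute mult.right_neutral)
    have scale': "z * (1 - k * t) * (k + 1 + k * t) = z" for z :: real
      using kt_beta by (metis mult.assoc mult.right_neutral)
    have "n * (1 + t) * (k * t) \<le> x * (k * t)"
      using n(1) kt_pos by (intro mult_right_mono) auto
    then have n1: "n \<le> x * (k * t)" unfolding scale .
    have "(x + 1) * (k * t) \<le> (real n + 1) * (1 + t) * (k * t)"
      using False kt_pos by (intro mult_right_mono) auto
    then have n2: "(x + 1) * (k * t) \<le> real n + 1" unfolding scale by simp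
    have "x * (k * t) \<le> x" using kt_less_1 by (simp add: mult_left_le)
    then have "n \<le> x" using n1 by linarith
    define m where "m = x - n"
    have m: "real m = real x - real n" using \<open>n \<le> x\<close> by (simp add: m_def)
    have pos: "k + 1 + k * t > 0" using kt_pos by linarith
    have "x * (1 - k * t) \<le> m" using n1 m by (simp add: algebra_simps)
    then have "x * (1 - k * t) * (k + 1 + k * t) \<le> m * (k + 1 + k * t)"
      using pos by (intro mult_right_mono) auto
    then have m1: "x \<le> m * (k + 1 + k * t)" unfolding scale' .
    have "m \<le> (real x + 1) * (1 - k * t)" using n2 m by (simp add: algebra_simps)
    then have "m * (k + 1 + k * t) \<le> (real x + 1) * (1 - k * t) * (k + 1 + k * t)"
      using pos by (intro mult_right_mono) auto
    then have m2: "m * (k + 1 + k * t) \<le> real x + 1" unfolding scale' .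
    have "m * (k + 1 + k * t) \<noteq> real x + 1"
    proof
      assume eq: "m * (k + 1 + k * t) = real x + 1"
      then have "m \<noteq> 0" by (intro notI) simp
      then have "k * m > 0" using k_pos by simp
      moreover have "real (k * m) * t = of_int (int x + 1 - int m * (int k + 1))"
        using eq by (simp add: algebra_simps)
      ultimately show False using t_irrational by blast
    qed
    then have "B m = x" using m1 m2 by (intro B_eqI) auto
    then show ?thesis by blast
  qed
qed

text \<open>For a common value \<open>x\<close>, adding the bounds for \<open>n\<close> and
  \<open>m\<close> gives \<open>x \<le> n + m < x + 1\<close>, so \<open>n + m = x\<close> and both
  lower bounds are attained. Then \<open>k * x * t\<close> is an integer, which forces
  \<open>x = 0\<close>.\<close>

lemma A_eq_B_D:
  assumes "A n = B m"
  shows "n = 0 \<and> m = 0"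
proof -
  define x where "x = A n"
  have x: "A n = x" "B m = x" using assms by (simp_all add: x_def)
  have scale: "z * (1 + t) * (k * t) = z" for z :: real
    using kt_alpha by (metis mult.assoc mult.commute mult.right_neutral)
  have scale': "z * (k + 1 + k * t) * (1 - k * t) = z" for z :: real
    using kt_beta by (metis mult.assoc mult.commute mult.right_neutral)
  have "x * (k * t) \<le> n * (1 + t) * (k * t)" "n * (1 + t) * (k * t) < (real x + 1) * (k * t)"
    using A_bounds[of n] x(1) kt_pos
    by (intro mult_right_mono mult_strict_right_mono; simp)+
  then have n: "x * (k * t) \<le> n" "n < (real x + 1) * (k * t)" unfolding scale .
  have pos: "1 - k * t > 0" using kt_less_1 by simp
  have "x * (1 - k * t) \<le> m * (k + 1 + k * t) * (1 - k * t)"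
    "m * (k + 1 + k * t) * (1 - k * t) < (real x + 1) * (1 - k * t)"
    using B_bounds[of m] x(2) pos
    by (intro mult_right_mono mult_strict_right_mono; simp)+
  then have m: "x * (1 - k * t) \<le> m" "m < (real x + 1) * (1 - k * t)" unfolding scale' .
  have "x \<le> n + m" "real n + real m < real x + 1"
    using n m by (simp_all add: algebra_simps)
  then have sum: "n + m = x" by linarith
  then have "real n = x * (k * t)"
    using n(1) m(1) sum by (simp add: right_diff_distrib)
  then have "real (k * x) * t = of_int (int n)" by (simp add: algebra_simps)
  then have "\<not> k * x > 0" using t_irrational by blast
  then show ?thesis using sum k_pos by simp
qed

lemma A_strict_mono: "m < n \<Longrightarrow> A m < A n"
proof -
  assume "m < n"
  then have "(real m + 1) * (1 + t) \<le> n * (1 + t)"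
    using t_pos by (intro mult_right_mono) auto
  then have "real (A m) + 1 \<le> n * (1 + t)"
    using A_bounds(1)[of m] t_pos by (simp add: algebra_simps)
  then show ?thesis using A_bounds(2)[of n] by linarith
qed

section \<open>Growth of the differences \<open>D\<close>\<close>

definition D :: "nat \<Rightarrow> int" where "D n = int (B n) - int (A n)"

text \<open>\<open>residue n\<close> is the number \<open>j < k\<close> for which the fractional part of \<open>n * alpha k\<close> lies in
  \<open>[j / k, (j + 1) / k)\<close>.\<close>

definition residue :: "nat \<Rightarrow> int" where "residue n = \<lfloor>k * (n * t)\<rfloor> - k * \<lfloor>n * t\<rfloor>"

lemma D_eq: "D n = int n * k + \<lfloor>k * (n * t)\<rfloor> - \<lfloor>n * t\<rfloor>"
  by (simp add: D_def A_eq B_eq algebra_simps)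

lemma D_0 [simp]: "D 0 = 0" by (simp add: D_def)

lemma residue_bounds: "0 \<le> residue n" "residue n < k"
proof -
  have k: "real k > 0" using k_pos by simp
  have "k * real_of_int \<lfloor>n * t\<rfloor> \<le> k * (n * t)"
    using k by (intro mult_left_mono) auto
  then have "of_int (k * \<lfloor>n * t\<rfloor>) \<le> k * (n * t)" by simp
  then show "0 \<le> residue n" unfolding residue_def by (metis diff_ge_0_iff_ge le_floor_iff)
  have "k * (n * t) < k * (real_of_int \<lfloor>n * t\<rfloor> + 1)"
    using k by (intro mult_strict_left_mono) auto
  then have "k * (n * t) < of_int (k * \<lfloor>n * t\<rfloor> + k)" by (simp add: algebra_simps)
  then have "\<lfloor>k * (n * t)\<rfloor> < k * \<lfloor>n * t\<rfloor> + k" by (metis floor_less_iff)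
  then show "residue n < k" unfolding residue_def by linarith
qed

text \<open>When \<open>n * t\<close> passes an integer \<open>p + 1\<close>, then
  \<open>k * (n * t)\<close> passes the integer \<open>k * (p + 1)\<close>, so a jump of the first
  floor comes with a jump of the second. The step is \<open>k + 1\<close> only when the second floor
  jumps alone; then \<open>k * (Suc n * t)\<close> has passed an integer by less than
  \<open>k * t\<close>.\<close>

lemma D_Suc:
  "D (Suc n) = D n + k \<or>
   D (Suc n) = D n + k + 1 \<and> residue (Suc n) \<ge> 1 \<and> frac (k * (Suc n * t)) < k * t"
proof -
  define p p' q q' where pq_def: "p = \<lfloor>n * t\<rfloor>" "p' = \<lfloor>n * t + t\<rfloor>"
    "q = \<lfloor>k * (n * t)\<rfloor>" "q' = \<lfloor>k * (n * t) + k * t\<rfloor>"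
  have Suc_eq: "Suc n * t = n * t + t" "k * (Suc n * t) = k * (n * t) + k * t"
    by (simp_all add: algebra_simps)
  have p: "p' = p \<or> p' = p + 1" and q: "q' = q \<or> q' = q + 1"
    unfolding pq_def using t_pos t_less_1 kt_pos kt_less_1 by linarith+
  have D: "D (Suc n) = D n + k + (q' - q) - (p' - p)"
    unfolding D_eq Suc_eq pq_def by (simp add: algebra_simps)
  have k: "real k > 0" using k_pos by simp
  have "q' = q + 1" if "p' = p + 1"
  proof -
    have "n * t < of_int (p + 1)" "of_int (p + 1) \<le> n * t + t"
      using that unfolding pq_def by linarith+
    then have "k * (n * t) < k * of_int (p + 1)" "k * of_int (p + 1) \<le> k * (n * t + t)"
      using k by simp_all
    then have "k * (n * t) < of_int (k * (p + 1))" "of_int (k * (p + 1)) \<le> k * (n * t) + k * t"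
      by (simp_all add: algebra_simps)
    then have "q < k * (p + 1)" "k * (p + 1) \<le> q'"
      unfolding pq_def by (simp_all add: floor_less_iff le_floor_iff)
    then show ?thesis using q by linarith
  qed
  moreover have "residue (Suc n) \<ge> 1 \<and> frac (k * (Suc n * t)) < k * t"
    if "p' = p" "q' = q + 1"
  proof
    have "k * real_of_int p \<le> k * (n * t)"
      using k unfolding pq_def by (intro mult_left_mono) auto
    then have "of_int (k * p) \<le> k * (n * t)" by simp
    then have "k * p \<le> q" unfolding pq_def by (simp add: le_floor_iff)
    moreover have "residue (Suc n) = q' - k * p'"
      unfolding residue_def pq_def Suc_eq(2) unfolding Suc_eq(1) ..
    ultimately show "residue (Suc n) \<ge> 1" using that by simp
    have "k * (n * t) < of_int q'" using that(2) unfolding pq_def by linarith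
    then show "frac (k * (Suc n * t)) < k * t"
      unfolding Suc_eq(2) frac_def pq_def(4)[symmetric] by linarith
  qed
  ultimately show ?thesis using p q D by auto
qed

lemma D_mono: "m < n \<Longrightarrow> D m + k \<le> D n"
proof (induction rule: less_Suc_induct)
  case (1 i)
  then show ?case using D_Suc[of i] by auto
qed (use k_pos in auto)

lemma D_nonneg: "D n \<ge> 0"
  using D_mono[of 0 n] by (cases n) auto

lemma D_ge: "n > 0 \<Longrightarrow> D n \<ge> k"
  using D_mono[of 0 n] by simp

lemma B_strict_mono: "m < n \<Longrightarrow> B m < B n"
  using A_strict_mono[of m n] D_mono[of m n] by (simp add: D_def)

lemma A_inject: "A m = A n \<longleftrightarrow> m = n"
  using A_strict_mono by (metis less_irrefl linorder_neqE_nat)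

lemma B_inject: "B m = B n \<longleftrightarrow> m = n"
  using B_strict_mono by (metis less_irrefl linorder_neqE_nat)

section \<open>The linear form \<open>phi\<close> on \<open>S k\<close>\<close>

text \<open>The linear form contracted by the matrix \<open>((1, 1), (k, k + 1))\<close> of the recursion for
  \<open>extra_seq\<close>; the contraction factor is \<open>1 - k * t = 1 / beta k\<close>.\<close>

definition phi :: "real \<Rightarrow> real \<Rightarrow> real" where "phi x y = y - (k + k * t) * x"

lemma phi_add: "phi (x + x') (y + y') = phi x y + phi x' y'"
  by (simp add: phi_def algebra_simps)

lemma phi_step: "phi (x + y) (k * x + (real k + 1) * y) = (1 - k * t) * phi x y" for x y :: real
proof -
  have "(1 - k * t) * phi x y - phi (x + y) (k * x + (real k + 1) * y)
      = (k * t * (1 + t) - 1) * (k * x)"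
    by (simp add: phi_def algebra_simps)
  then show ?thesis using kt_alpha by simp
qed

text \<open>The terms in \<open>n\<close> add up to \<open>n * (1 - k * t) = n * k * t * t\<close>;
  combined with \<open>- k * t * \<lfloor>n * t\<rfloor>\<close> they leave \<open>t\<close> times
  the sum of \<open>residue n\<close> and a fractional part.\<close>

lemma phi_A_B: "phi (A n) (B n) = residue n * (1 + t) + t * frac (k * (n * t))"
proof -
  have A: "real (A n) = n + of_int \<lfloor>n * t\<rfloor>"
    using A_eq[of n] by (metis of_int_add of_int_of_nat_eq)
  have B: "real (B n) = n * (k + 1) + of_int \<lfloor>k * (n * t)\<rfloor>"
    using arg_cong[OF B_eq[of n], of real_of_int]
    by (simp add: algebra_simps)
  have "n * (k * t * t) = n * (1 - k * t)" using t_eq by simp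
  then show ?thesis
    unfolding phi_def A B residue_def frac_def by (simp add: algebra_simps)
qed

lemma phi_A_B_nonneg: "phi (A n) (B n) \<ge> 0"
  using residue_bounds(1)[of n] t_pos by (simp add: phi_A_B)

text \<open>Recognizes the points of \<open>S k\<close> with residue 0. The multiples
  \<open>m * alpha k\<close> and \<open>m * beta k\<close> exceed \<open>a\<close> and
  \<open>b\<close> by \<open>phi\<close> times \<open>1 + t\<close> and \<open>k * (1 + t)\<close>,
  both below 1 because \<open>k * t * (1 + t) = 1\<close>.\<close>

lemma phi_less_tE:
  assumes "0 \<le> phi (real a) (real b)" "phi (real a) (real b) < t"
  obtains m where "a = A m" "b = B m"
proof -
  let ?p = "phi (real a) (real b)"
  \<comment> \<open>The index is forced: at residue 0, \<open>B m = m + k * A m\<close>.\<close>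
  define m where "m = b - k * a"
  have b: "real b = ?p + k * t * a + k * a" by (simp add: phi_def algebra_simps)
  moreover have "k * t * a \<ge> 0" using kt_pos by simp
  ultimately have "real (k * a) \<le> real b" using assms(1) by simp
  then have "k * a \<le> b" by (metis of_nat_le_iff)
  then have m: "real m = ?p + k * t * a" using b by (simp add: m_def)
  have "k * t * (1 + t) * a = a" using kt_alpha by simp
  then have mt: "m * (1 + t) = a + ?p * (1 + t)"
    unfolding m by (simp add: algebra_simps)
  have "?p * (1 + t) \<ge> 0" using assms t_pos by simp
  have k: "real k \<ge> 1" using k_pos by simp
  have "?p * (1 + t) < t * (1 + t)" using assms t_pos by (intro mult_strict_right_mono) auto
  then have "k * (?p * (1 + t)) < k * (t * (1 + t))" using k by (intro mult_strict_left_mono) auto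
  then have lt: "k * (?p * (1 + t)) < 1" using kt_alpha by (simp add: algebra_simps)
  have le: "?p * (1 + t) \<le> k * (?p * (1 + t))"
    using k \<open>?p * (1 + t) \<ge> 0\<close> by (metis mult_le_cancel_right1 linorder_not_le)
  have "A m = a"
    using mt \<open>?p * (1 + t) \<ge> 0\<close> lt le by (intro A_eqI) linarith+
  moreover have "m * (k + 1 + k * t) = m + k * (m * (1 + t))" by (simp add: algebra_simps)
  moreover have "real b = m + k * a" using b m by simp
  ultimately have "A m = a" "m * (k + 1 + k * t) = b + k * (?p * (1 + t))"
    unfolding mt by (simp_all add: distrib_left)
  moreover from this have "B m = b"
    using \<open>?p * (1 + t) \<ge> 0\<close> lt le by (intro B_eqI) linarith+
  ultimately show thesis using that by blast
qed

section \<open>The extra sequences under \<open>phi\<close>\<close>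

lemma extra_seq_Suc:
  "fst (extra_seq k i (Suc n)) = fst (extra_seq k i n) + snd (extra_seq k i n)"
  "snd (extra_seq k i (Suc n)) = k * fst (extra_seq k i n) + (k + 1) * snd (extra_seq k i n) + i"
  by (simp_all add: split_beta Let_def)

text \<open>On \<open>phi\<close> the recursion acts as
  \<open>z \<mapsto> (1 - k * t) * z + i\<close>, with fixed point
  \<open>i / (k * t) = i * (1 + t)\<close>. The initial pair has \<open>phi = i + 1\<close>, which
  deviates from it by \<open>1 - i * t\<close>.\<close>

lemma phi_extra_seq:
  "phi (fst (extra_seq k i n)) (snd (extra_seq k i n)) = i * (1 + t) + (1 - i * t) * (1 - k * t) ^ n"
proof (induction n)
  case 0
  show ?case by (simp add: phi_def algebra_simps)
next
  case (Suc n)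
  let ?f = "real (fst (extra_seq k i n))" and ?g = "real (snd (extra_seq k i n))"
  have "phi (fst (extra_seq k i (Suc n))) (snd (extra_seq k i (Suc n)))
      = phi (?f + ?g) (k * ?f + (real k + 1) * ?g) + i"
    unfolding extra_seq_Suc by (simp add: phi_def algebra_simps)
  also have "\<dots> = (1 - k * t) * phi ?f ?g + i"
    unfolding phi_step ..
  also have "\<dots> = (1 - k * t) * (i * (1 + t) + (1 - i * t) * (1 - k * t) ^ n) + i"
    unfolding Suc ..
  also have "\<dots> = (1 - k * t * (1 + t)) * i + i * (1 + t) + (1 - i * t) * (1 - k * t) ^ Suc n"
    by (simp add: algebra_simps)
  finally show ?case using kt_alpha by simp
qed

lemma it_bounds:
  assumes "1 \<le> i" "i < k"
  shows "t \<le> i * t" "i * t < k * t"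
  using assms t_pos by simp_all

lemma phi_extra_bounds:
  assumes "1 \<le> i" "i < k" "n > 0"
  shows "i * (1 + t) < phi (fst (extra_seq k i n)) (snd (extra_seq k i n))"
    and "phi (fst (extra_seq k i n)) (snd (extra_seq k i n)) < i * (1 + t) + (1 - t)"
proof -
  have pos: "1 - k * t > 0" "1 - i * t > 0" "1 - i * t \<le> 1 - t" "1 - k * t < 1"
    using it_bounds[OF assms(1,2)] kt_less_1 kt_pos by linarith+
  then show "i * (1 + t) < phi (fst (extra_seq k i n)) (snd (extra_seq k i n))"
    unfolding phi_extra_seq by simp
  have "(1 - k * t) ^ n < 1" using pos assms(3) by (intro power_less_one_iff[THEN iffD2]) auto
  then have "(1 - i * t) * (1 - k * t) ^ n < 1 - i * t" using pos by simp
  then show "phi (fst (extra_seq k i n)) (snd (extra_seq k i n)) < i * (1 + t) + (1 - t)"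
    unfolding phi_extra_seq using pos by linarith
qed

text \<open>Descent along the inverse of the affine map that generates \<open>extra_seq\<close>: it keeps the
  position nonnegative and multiplies \<open>phi a b - i * (1 + t)\<close> by \<open>beta k\<close>.\<close>

lemma extra_seq_subtract:
  assumes "1 \<le> i" "i < k" "0 < phi (real a) (real b) - i * (1 + t)"
    "phi (real a) (real b) - i * (1 + t) < 1 - i * t"
  shows "\<exists>n>0. \<exists>c d. a = fst (extra_seq k i n) + c \<and> b = snd (extra_seq k i n) + d \<and>
    0 \<le> phi (real c) (real d) \<and> phi (real c) (real d) \<le> phi (real a) (real b) - i * (1 + t)"
  using assms(3,4)
proof (induction a arbitrary: b rule: less_induct)
  case (less a)
  define \<delta> where "\<delta> = phi (real a) (real b) - i * (1 + t)"
  have \<delta>: "0 < \<delta>" "\<delta> < 1 - i * t" using less.prems by (simp_all add: \<delta>_def)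
  let ?\<beta> = "k + 1 + k * t"
  have \<beta>: "?\<beta> > 0" using kt_pos by linarith
  define y where "y = int b - k * a - i"
  define x where "x = int a - y"
  have ab: "int a = x + y" "int b = k * x + (k + 1) * y + i"
    by (simp_all add: x_def y_def algebra_simps)
  have rab: "real a = of_int x + of_int y" "real b = k * real_of_int x + (k + 1) * of_int y + i"
    using ab[THEN arg_cong, of real_of_int] by simp_all
  have "phi (real a) (real b) = phi (of_int x + of_int y) (k * real_of_int x + (real k + 1) * of_int y) + i"
    unfolding rab by (simp add: phi_def algebra_simps)
  also have "\<dots> = (1 - k * t) * phi (of_int x) (of_int y) + i"
    unfolding phi_step ..
  finally have "(1 - k * t) * phi (of_int x) (of_int y) = \<delta> + i * t"
    by (simp add: \<delta>_def algebra_simps)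
  then have "?\<beta> * ((1 - k * t) * phi (of_int x) (of_int y)) = ?\<beta> * (\<delta> + i * t)" by simp
  moreover have "?\<beta> * ((1 - k * t) * z) = z" for z :: real
    using kt_beta by (metis mult.assoc mult.commute mult.left_neutral)
  moreover have t\<beta>: "t * ?\<beta> = 1 + t" using t_eq by (simp add: algebra_simps)
  moreover have "?\<beta> * (\<delta> + i * t) = i * (t * ?\<beta>) + ?\<beta> * \<delta>"
    by (simp add: algebra_simps)
  ultimately have phi_xy: "phi (of_int x) (of_int y) = i * (1 + t) + ?\<beta> * \<delta>"
    by (simp only:)
  have "of_int y = phi (real a) (real b) + k * t * a - i"
    by (simp add: y_def phi_def algebra_simps)
  moreover have "k * t * a \<ge> 0" "i * t > 0" using kt_pos t_pos assms(1) by simp_all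
  ultimately have "real_of_int y > 0"
    using \<delta>(1) unfolding \<delta>_def by (simp add: algebra_simps)
  then have y: "y \<ge> 1" by simp
  \<comment> \<open>With \<open>x \<le> -1\<close> and \<open>y \<ge> 1\<close>, \<open>phi\<close>
    would be at least \<open>?\<beta>\<close>. The bound \<open>\<delta> < 1 - i * t\<close> rules
    this out, since \<open>t * ?\<beta> = 1 + t\<close>.\<close>
  have x: "x \<ge> 0"
  proof (rule ccontr)
    assume "\<not> x \<ge> 0"
    then have "(k + k * t) * of_int x \<le> (k + k * t) * (-1)"
      using kt_pos by (intro mult_left_mono) auto
    moreover have "real_of_int y \<ge> 1" using y by simp
    ultimately have "phi (of_int x) (of_int y) \<ge> ?\<beta>"
      by (simp add: phi_def)
    moreover have "?\<beta> * \<delta> < ?\<beta> * (1 - i * t)"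
      using \<delta>(2) \<beta> by (rule mult_strict_left_mono)
    moreover have "?\<beta> * (1 - i * t) = ?\<beta> - i * (t * ?\<beta>)"
      by (simp add: algebra_simps)
    then have "?\<beta> * (1 - i * t) = ?\<beta> - i * (1 + t)" unfolding t\<beta> .
    ultimately show False using phi_xy by linarith
  qed
  define x' y' where "x' = nat x" and "y' = nat y"
  have xy': "real x' = of_int x" "real y' = of_int y"
    using x y by (simp_all add: x'_def y'_def)
  have a: "a = x' + y'" and b: "b = k * x' + (k + 1) * y' + i"
  proof -
    have "int x' = x" "int y' = y" using x y by (simp_all add: x'_def y'_def)
    then have "int a = int (x' + y')" "int b = int (k * x' + (k + 1) * y' + i)"
      using ab by (simp_all add: algebra_simps)
    then show "a = x' + y'" "b = k * x' + (k + 1) * y' + i"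
      unfolding of_nat_eq_iff .
  qed
  have phi': "phi (real x') (real y') = i * (1 + t) + ?\<beta> * \<delta>"
    using phi_xy xy' by simp
  have "\<exists>n c d. x' = fst (extra_seq k i n) + c \<and> y' = snd (extra_seq k i n) + d \<and>
    0 \<le> phi (real c) (real d) \<and> phi (real c) (real d) \<le> ?\<beta> * \<delta>"
  \<comment> \<open>The descent stops once the deviation reaches \<open>1 - i * t\<close>, that of
    the initial pair \<open>(0, i + 1)\<close>: this pair can then be subtracted with
    \<open>phi\<close> staying nonnegative.\<close>
  proof (cases "?\<beta> * \<delta> < 1 - i * t")
    case True
    have "x' < a" using y by (simp add: a y'_def)
    moreover have "?\<beta> * \<delta> > 0" using \<beta> \<delta> by simp
    ultimately show ?thesis
      using less.IH[of x' y'] True unfolding phi' by auto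
  next
    case False
    have "(k + k * t) * x' \<ge> 0" using kt_pos by simp
    then have "real y' \<ge> i + 1"
      using phi' False unfolding phi_def by (simp add: algebra_simps)
    then have "y' \<ge> i + 1" by (simp only: of_nat_le_iff)
    then obtain d where d: "y' = (i + 1) + d" using le_Suc_ex by blast
    have "phi (real x') (real d) = phi (real x') (real y') - (i + 1)"
      by (simp add: phi_def d)
    also have "\<dots> = ?\<beta> * \<delta> - (1 - i * t)" unfolding phi' by (simp add: algebra_simps)
    finally have "phi (real x') (real d) = ?\<beta> * \<delta> - (1 - i * t)" .
    moreover have "1 - i * t > 0" using \<delta> by linarith
    ultimately show ?thesis
      using d False by (intro exI[of _ 0] exI[of _ x'] exI[of _ d]) auto
  qed
  then obtain n c d where ncd: "x' = fst (extra_seq k i n) + c" "y' = snd (extra_seq k i n) + d"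
    "0 \<le> phi (real c) (real d)" "phi (real c) (real d) \<le> ?\<beta> * \<delta>"
    by blast
  \<comment> \<open>The remainder follows the linear part of the recursion only, since the constant
    \<open>i\<close> is absorbed by \<open>extra_seq\<close>. This contracts its \<open>phi\<close>
    from at most \<open>?\<beta> * \<delta>\<close> to at most \<open>\<delta>\<close>.\<close>
  have phi_cd: "phi (real (c + d)) (real (k * c + (k + 1) * d)) = (1 - k * t) * phi (real c) (real d)"
    using phi_step[of "real c" "real d"] by (simp add: distrib_right add.commute)
  have "(1 - k * t) * phi (real c) (real d) \<ge> 0"
    using ncd(3) kt_less_1 by simp
  moreover have "(1 - k * t) * phi (real c) (real d) \<le> (1 - k * t) * (?\<beta> * \<delta>)"
    using ncd(4) kt_less_1 by (intro mult_left_mono) auto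
  then have "(1 - k * t) * phi (real c) (real d) \<le> \<delta>"
    using kt_beta by (metis mult.assoc mult.left_neutral)
  moreover have "a = fst (extra_seq k i (Suc n)) + (c + d)"
    "b = snd (extra_seq k i (Suc n)) + (k * c + (k + 1) * d)"
    unfolding extra_seq_Suc a b ncd by (simp_all add: algebra_simps)
  ultimately show ?case
    unfolding \<delta>_def[symmetric] phi_cd[symmetric] by blast
qed

section \<open>No move joins two points of \<open>S k\<close>\<close>

definition moves :: "(nat \<times> nat) set" where
  "moves = nim_moves \<union> diagonal_moves k \<union> extra_moves k"

lemma moves_cases [consumes 1, case_names nim diagonal extra]:
  assumes "(u, v) \<in> moves"
  obtains "u > 0" "v = 0"
  | "u > 0" "v > 0" "\<bar>int u - int v\<bar> < k"
  | i n where "1 \<le> i" "i < k" "n > 0"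
      "u = fst (extra_seq k i n)" "snd (extra_seq k i n) = v + 1"
proof -
  consider "(u, v) \<in> nim_moves" | "(u, v) \<in> diagonal_moves k" | "(u, v) \<in> extra_moves k"
    using assms by (auto simp: moves_def)
  then show thesis
  proof cases
    case 1
    then show thesis using that(1) by (simp add: nim_moves_def)
  next
    case 2
    then show thesis using that(2) by (simp add: diagonal_moves_def)
  next
    case 3
    then obtain i n where i: "1 \<le> i" "i \<le> k - 1" "n > 0"
      "u = fst (extra_seq k i n)" "v = snd (extra_seq k i n) - 1"
      unfolding extra_moves_def by blast
    have "i < k" using i(2) k_pos by linarith
    moreover have "snd (extra_seq k i n) = v + 1"
      using extra_seq_pos(1)[of k i n] i(5) by linarith
    ultimately show thesis using that(3) i by blast
  qed
qed

text \<open>Taking 1 from the second component lowers \<open>phi\<close> by 1, which places it in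
  the gap between \<open>j * (1 + t) + t\<close> and \<open>(j + 1) * (1 + t) - t\<close> for
  \<open>j = i - 1\<close>.\<close>

lemma phi_extra_move:
  assumes "1 \<le> i" "i < k" "n > 0" "u = fst (extra_seq k i n)" "snd (extra_seq k i n) = v + 1"
  shows "(real i - 1) * (1 + t) + t < phi u v" "phi u v < (real i - 1) * (1 + t) + 1" "u > 0" "u < v"
proof -
  have eq: "phi (fst (extra_seq k i n)) (snd (extra_seq k i n)) = phi u v + 1"
    unfolding assms(4,5) phi_def by simp
  show lower: "(real i - 1) * (1 + t) + t < phi u v" and "phi u v < (real i - 1) * (1 + t) + 1"
    using phi_extra_bounds[OF assms(1-3)] unfolding eq by (simp_all add: algebra_simps)
  show "u > 0" using extra_seq_pos(2) assms by simp
  have "(real i - 1) * (1 + t) \<ge> 0" using assms(1) t_pos by simp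
  then have "(k + k * t) * u < v" using lower t_pos unfolding phi_def by linarith
  moreover have "1 * real u \<le> (k + k * t) * u"
    using k_pos kt_pos by (intro mult_right_mono) auto
  ultimately show "u < v" by simp
qed

lemma no_move_parallel:
  assumes "(u, v) \<in> moves" "A n = A m + u" "B n = B m + v"
  shows False
  using assms(1)
proof (cases rule: moves_cases)
  case nim
  then show ?thesis using assms by (simp add: B_inject)
next
  case diagonal
  then have "n \<noteq> m" using assms by auto
  moreover have "D n - D m = int v - int u" using assms by (simp add: D_def)
  ultimately show ?thesis
    using diagonal(3) D_mono[of n m] D_mono[of m n] by (cases "n < m") auto
next
  case (extra i j)
  note bounds = phi_extra_move[OF extra]
  \<comment> \<open>Two values of \<open>phi\<close> on \<open>S k\<close> differ by an integer
    multiple of \<open>1 + t\<close> plus an error \<open>e\<close> with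
    \<open>\<bar>e\<bar> < t\<close>. The gap for extra moves would put the integer \<open>z\<close>
    strictly between 0 and 1.\<close>
  define z where "z = residue n - residue m - int i + 1"
  define e where "e = t * frac (k * (n * t)) - t * frac (k * (m * t))"
  have "t * frac (k * (n * t)) \<ge> 0" "t * frac (k * (n * t)) < t"
    "t * frac (k * (m * t)) \<ge> 0" "t * frac (k * (m * t)) < t"
    using t_pos by (simp_all add: frac_lt_1)
  then have e: "\<bar>e\<bar> < t" unfolding e_def by linarith
  have "phi (A n) (B n) = phi (A m) (B m) + phi u v"
    using assms by (simp add: phi_add)
  then have "z * (1 + t) = phi u v - (real i - 1) * (1 + t) - e"
    unfolding phi_A_B z_def e_def by (simp add: algebra_simps)
  moreover have "0 < phi u v - (real i - 1) * (1 + t) - e"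
    "phi u v - (real i - 1) * (1 + t) - e < 1 + t"
    using e bounds(1,2) by (simp_all only: abs_less_iff) linarith+
  ultimately have "0 < z * (1 + t)" "z * (1 + t) < 1 * (1 + t)" by simp_all
  then have "0 < z" "z < 1"
    using t_pos by (simp_all add: zero_less_mult_iff)
  then show False by simp
qed

text \<open>A diagonal move fails because \<open>v - u = D n + D m \<ge> k\<close>. An extra move
  has \<open>phi u v < k + k * t\<close>, too little to lift the very negative
  \<open>phi (B m) (A m)\<close> to a nonnegative value unless \<open>m = 0\<close>, where the
  crossed and parallel cases coincide.\<close>

lemma no_move_crossed:
  assumes "(u, v) \<in> moves" "A n = B m + u" "B n = A m + v"
  shows False
  using assms(1)
proof (cases rule: moves_cases)
  case nim
  then show ?thesis using assms A_eq_B_D[of m n] by auto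
next
  case diagonal
  then have "n > 0" using assms by (intro gr0I) auto
  moreover have "D n + D m = int v - int u" using assms by (simp add: D_def)
  ultimately show ?thesis
    using diagonal(3) D_ge[of n] D_nonneg[of m] by simp
next
  case (extra i j)
  note bounds = phi_extra_move[OF extra]
  show False
  proof (cases "m = 0")
    case True
    then show ?thesis using assms no_move_parallel[of u v n 0] by simp
  next
    case False
    then have D: "int (A m) + k \<le> B m" using D_ge[of m] by (simp add: D_def)
    then have Dr: "real (A m) + k \<le> B m"
      by (metis of_int_le_iff of_int_add of_int_of_nat_eq)
    have "(real i - 1) * (1 + t) \<le> (real k - 1) * (1 + t)"
      using extra(2) t_pos by (intro mult_right_mono) auto
    then have "phi u v < k + k * t" using bounds(2) t_pos by (simp add: algebra_simps)
    moreover have "phi (A n) (B n) = phi (B m) (A m) + phi u v"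
      using assms by (simp add: phi_add)
    moreover note phi_A_B_nonneg[of n]
    ultimately have "(k + k * t) * (real (B m) - 1) < A m"
      by (simp add: phi_def algebra_simps)
    moreover have "1 * (real (B m) - 1) \<le> (k + k * t) * (real (B m) - 1)"
      using k_pos kt_pos Dr by (intro mult_right_mono) auto
    ultimately have "real (B m) - 1 < real (A m)" by simp
    then show False using D k_pos by simp
  qed
qed

text \<open>Diagonal moves are symmetric, and extra moves have \<open>u < v\<close>: they would
  force \<open>D n < D m\<close> and \<open>B m < B n\<close>, although \<open>D\<close> and
  \<open>B\<close> both increase.\<close>

lemma no_move_parallel':
  assumes "(u, v) \<in> moves" "B n = B m + u" "A n = A m + v"
  shows False
  using assms(1)
proof (cases rule: moves_cases)
  case nim
  then show ?thesis using assms by (simp add: A_inject)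
next
  case diagonal
  then have "(v, u) \<in> moves" by (simp add: moves_def diagonal_moves_def abs_minus_commute)
  then show ?thesis using assms no_move_parallel by blast
next
  case (extra i j)
  note bounds = phi_extra_move[OF extra]
  then have "D n < D m" "B m < B n" using assms by (simp_all add: D_def)
  moreover from this have "\<not> m < n" "\<not> n < m"
    using D_mono[of m n] B_strict_mono[of n m] by auto
  ultimately show False by simp
qed

lemma no_move_crossed':
  assumes "(u, v) \<in> moves" "B n = A m + u" "A n = B m + v"
  shows False
  using assms(1)
proof (cases rule: moves_cases)
  case nim
  then show ?thesis using assms A_eq_B_D[of n m] by auto
next
  case diagonal
  then have "(v, u) \<in> moves" by (simp add: moves_def diagonal_moves_def abs_minus_commute)
  then show ?thesis using assms no_move_crossed by blast
next
  case (extra i j)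
  then show False
    using phi_extra_move(4)[OF extra] assms D_nonneg[of n] D_nonneg[of m] by (simp add: D_def)
qed

lemma S_eq: "S k = {Upair (A n) (B n) | n. True}"
  by (simp add: S_def A_def B_def)

lemma no_move_within_S:
  assumes "p \<in> S k" "Gamma_move k p q"
  shows "q \<notin> S k"
proof
  assume "q \<in> S k"
  then obtain n m where nm: "p = Upair (A n) (B n)" "q = Upair (A m) (B m)"
    using assms(1) unfolding S_eq by blast
  from assms(2) obtain u v x y where uv: "(u, v) \<in> moves" "u \<le> x" "v \<le> y"
    and xy: "p = Upair x y" "q = Upair (x - u) (y - v)"
    unfolding Gamma_move_def moves_def by (blast elim: two_heap_move.cases)
  have "Upair x y = Upair (A n) (B n)" "Upair (x - u) (y - v) = Upair (A m) (B m)"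
    using xy nm by metis+
  then have "x = A n \<and> y = B n \<or> x = B n \<and> y = A n"
    "x = A m + u \<and> y = B m + v \<or> x = B m + u \<and> y = A m + v"
    using uv(2,3) unfolding Upair_inject by linarith+
  then show False
    using no_move_parallel[OF uv(1)] no_move_crossed[OF uv(1)]
      no_move_parallel'[OF uv(1)] no_move_crossed'[OF uv(1)] by metis
qed

section \<open>A move into \<open>S k\<close> from every other position\<close>

lemma Gamma_moveI:
  assumes "(u, v) \<in> moves" "x = x' + u" "y = y' + v"
  shows "Gamma_move k (Upair x y) (Upair x' y')"
  using two_heap_move.intros[of u v moves x y] assms
  by (simp add: Gamma_move_def moves_def)

text \<open>Locate the heap difference \<open>d\<close> between consecutive values of
  \<open>D\<close>. If it is within \<open>k\<close> of \<open>D m\<close>, a diagonal move reaches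
  index \<open>m\<close>; otherwise \<open>d = D (Suc m) - 1\<close>, and the target is index
  \<open>Suc m\<close> or, when \<open>Suc m = n\<close>, the endpoint of an extra move.\<close>

lemma move_into_S_D:
  assumes "A n \<le> y" "y < B n"
  shows "\<exists>q \<in> S k. Gamma_move k (Upair (A n) y) q"
proof -
  define d where "d = int y - int (A n)"
  have d: "0 \<le> d" "d < D n" using assms by (simp_all add: d_def D_def)
  have "\<exists>m<n. D m \<le> d \<and> d < D (Suc m)"
    using d(2)
  proof (induction n)
    case 0
    then show ?case using d(1) by simp
  next
    case (Suc n)
    then show ?case by (cases "d < D n") (auto intro: less_SucI)
  qed
  then obtain m where m: "m < n" "D m \<le> d" "d < D (Suc m)" by blast
  have in_S: "Upair (A j) (B j) \<in> S k" for j unfolding S_eq by blast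
  consider "d < D m + k" | "d = D m + k" "D (Suc m) = D m + k + 1" "residue (Suc m) \<ge> 1"
      "frac (k * (Suc m * t)) < k * t"
    using D_Suc[of m] m by linarith
  then show ?thesis
  proof cases
    case 1
    define u v where "u = A n - A m" and "v = y - B m"
    have "u > 0" and A: "A n = A m + u" using A_strict_mono[OF m(1)] by (simp_all add: u_def)
    have "int y - int (B m) = u + (d - D m)" using A by (simp add: d_def D_def)
    then have "y = B m + v" "v > 0" "\<bar>int u - int v\<bar> < k"
      using m(2) 1 \<open>u > 0\<close> by (simp_all add: v_def)
    then show ?thesis
      using \<open>u > 0\<close> A in_S Gamma_moveI[of u v "A n" "A m" y "B m"]
      by (auto simp: moves_def diagonal_moves_def)
  next
    case 2
    \<comment> \<open>A positive residue below \<open>k\<close> exists; hence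
      \<open>(u, u - 1)\<close> is a diagonal move, or a Nim move when \<open>u = 1\<close>.\<close>
    have k2: "k \<ge> 2" using 2(3) residue_bounds(2)[of "Suc m"] by simp
    show ?thesis
    proof (cases "Suc m = n")
      case False
      then have "Suc m < n" using m(1) by simp
      define u where "u = A n - A (Suc m)"
      have "u > 0" and A: "A n = A (Suc m) + u"
        using A_strict_mono[OF \<open>Suc m < n\<close>] by (simp_all add: u_def)
      have "y = B (Suc m) + (u - 1)"
        using 2(1,2) A \<open>u > 0\<close> by (simp add: d_def D_def)
      moreover have "(u, u - 1) \<in> moves"
        using \<open>u > 0\<close> k2 by (cases "u = 1") (auto simp: moves_def nim_moves_def diagonal_moves_def)
      ultimately show ?thesis using A in_S Gamma_moveI by blast
    next
      case True
      \<comment> \<open>With this \<open>i\<close>, \<open>phi (A n) (B n)\<close> exceeds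
        \<open>i * (1 + t)\<close> by less than \<open>t * (k * t) = 1 - k * t\<close>, as the
        subtraction lemma requires. It is applied to \<open>B n = y + 1\<close>, matching the 1
        taken off in extra moves; the remainder has \<open>phi < t\<close> and so lies in
        \<open>S k\<close>.\<close>
      define i where "i = nat (residue n)"
      have i: "1 \<le> i" "i < k" "residue n = int i"
        using 2(3) True residue_bounds(2)[of n] by (simp_all add: i_def)
      have y: "B n = y + 1" using 2(1,2) True by (simp add: d_def D_def)
      define \<delta> where "\<delta> = t * frac (k * (n * t))"
      have phi: "phi (A n) (B n) - i * (1 + t) = \<delta>"
        unfolding phi_A_B \<delta>_def using i by simp
      have "k * n > 0" using True k_pos by simp
      have "frac (k * (n * t)) \<noteq> 0"
      proof
        assume "frac (k * (n * t)) = 0"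
        then have "real (k * n) * t = of_int \<lfloor>k * (n * t)\<rfloor>"
          by (simp add: frac_def algebra_simps)
        then show False using t_irrational[OF \<open>k * n > 0\<close>] by blast
      qed
      then have "\<delta> > 0" using t_pos by (simp add: \<delta>_def less_le)
      have "\<delta> < t * (k * t)"
        unfolding \<delta>_def using 2(4) True t_pos by (intro mult_strict_left_mono) auto
      moreover have "t * (k * t) < t * 1"
        using kt_less_1 t_pos by (rule mult_strict_left_mono)
      moreover have "t * (k * t) = 1 - k * t"
        using t_eq by (simp add: mult.commute)
      ultimately have \<delta>: "\<delta> < 1 - k * t" "\<delta> < t" by linarith+
      then have "\<delta> < 1 - i * t" using it_bounds[OF i(1,2)] by linarith
      then obtain j c e where j: "j > 0" "A n = fst (extra_seq k i j) + c"
        "B n = snd (extra_seq k i j) + e" "0 \<le> phi (real c) (real e)" "phi (real c) (real e) \<le> \<delta>"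
        using extra_seq_subtract[OF i(1,2), of "A n" "B n"] \<open>\<delta> > 0\<close> unfolding phi by blast
      then obtain l where l: "c = A l" "e = B l"
        using phi_less_tE[of c e] \<delta>(2) by auto
      have "(fst (extra_seq k i j), snd (extra_seq k i j) - 1) \<in> moves"
        using i(1,2) j(1) unfolding moves_def extra_moves_def by fastforce
      moreover have "A n = A l + fst (extra_seq k i j)"
        using j(2) l by simp
      moreover have "y = B l + (snd (extra_seq k i j) - 1)"
        using y j(3) extra_seq_pos(1)[of k i j] l by simp
      ultimately show ?thesis
        using in_S Gamma_moveI by blast
    qed
  qed
qed

text \<open>By Beatty the smaller heap is some \<open>A n\<close> or \<open>B n\<close>. Whenever
  the other heap exceeds the partner of this entry, a Nim move suffices; only
  \<open>x = A n\<close>, \<open>y < B n\<close> needs the previous lemma.\<close>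

lemma move_into_S_le:
  assumes "x \<le> y" "Upair x y \<notin> S k"
  shows "\<exists>q \<in> S k. Gamma_move k (Upair x y) q"
proof -
  have in_S: "Upair (A j) (B j) \<in> S k" for j unfolding S_eq by blast
  have nim: "Gamma_move k (Upair x y) (Upair x y')" if "y' < y" for y'
  proof -
    have "(y - y', 0) \<in> moves" using that by (simp add: moves_def nim_moves_def)
    then have "Gamma_move k (Upair y x) (Upair y' x)"
      using that by (intro Gamma_moveI[of "y - y'" 0]) auto
    then show ?thesis by (metis Upair_commute)
  qed
  obtain n where "x = A n \<or> x = B n" using A_or_B by blast
  then consider "x = A n" | "x = B n" "x \<noteq> A n" by blast
  then show ?thesis
  proof cases
    case 1
    show ?thesis
    proof (cases "y < B n")
      case True
      then show ?thesis using move_into_S_D[of n y] 1 assms(1) by simp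
    next
      case False
      moreover have "y \<noteq> B n" using 1 assms(2) in_S by blast
      ultimately show ?thesis using nim[of "B n"] 1 in_S by auto
    qed
  next
    case 2
    have "A n < y" using 2 assms(1) D_nonneg[of n] by (simp add: D_def)
    then show ?thesis using nim[of "A n"] 2 in_S[of n] by (metis Upair_commute)
  qed
qed

lemma move_into_S:
  assumes "p \<notin> S k"
  shows "\<exists>q \<in> S k. Gamma_move k p q"
proof -
  obtain x y where "p = Upair x y" by (cases p) auto
  then show ?thesis
    using move_into_S_le[of x y] move_into_S_le[of y x] assms
    by (metis Upair_commute linear)
qed

section \<open>Identification of the P-positions\<close>

lemma P_position_iff_S: "P_position (Gamma_move k) p \<longleftrightarrow> p \<in> S k"
proof (induction p rule: measure_induct_rule[of tokens])
  case (less p)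
  then have "P_position (Gamma_move k) p \<longleftrightarrow> (\<forall>q. Gamma_move k p q \<longrightarrow> q \<notin> S k)"
    by (subst Gamma_P_position_iff) (metis Gamma_move_tokens)
  then show ?case using no_move_within_S move_into_S by metis
qed

end

theorem theorem3:
  fixes k :: nat
  assumes "k \<ge> 1"
  shows "{p. P_position (Gamma_move k) p} = S k"
  using wythoff_game.P_position_iff_S[OF wythoff_game.intro[OF assms]] by blast

end
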